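(* Let $k=\lfloor n/2\rfloor$ and let $t$ be an integer. For $1\le i\le n-1$ let $T_{(i)}$ be the tree on $n$ vertices obtained from the path $P_{n-1}$ by adding one new vertex $v_{(i)}$ joined by an edge to the $i$-th vertex of $P_{n-1}$ (counted from left to right), and write $\mathcal{E}(v_{(i)})=\mathcal{E}_{T_{(i)}}(v_{(i)})$ for the energy of the added vertex in $T_{(i)}$. Then $\mathcal{E}(v_{(i)})$ depends on $i$ in the following form: (1) if $n=4t$, $$\mathcal{E}(v_{(2)})<\mathcal{E}(v_{(4)})<\cdots<\mathcal{E}(v_{(k)})<\mathcal{E}(v_{(k-1)})<\mathcal{E}(v_{(k-3)})<\cdots<\mathcal{E}(v_{(3)})<\mathcal{E}(v_{(1)});$$ (2) if $n=4t+2$, $$\mathcal{E}(v_{(2)})<\mathcal{E}(v_{(4)})<\cdots<\mathcal{E}(v_{(k-1)})<\mathcal{E}(v_{(k)})<\mathcal{E}(v_{(k-2)})<\cdots<\mathcal{E}(v_{(3)})<\mathcal{E}(v_{(1)});$$ (3) if $n=4t+1$, $$\mathcal{E}(v_{(2)})<\mathcal{E}(v_{(4)})<\cdots<\mathcal{E}(v_{(k)})<\mathcal{E}(v_{(k+1)})<\mathcal{E}(v_{(k-1)})<\cdots<\mathcal{E}(v_{(3)})<\mathcal{E}(v_{(1)});$$ (4) if $n=4t+3$, $$\mathcal{E}(v_{(2)})<\mathcal{E}(v_{(4)})<\cdots<\mathcal{E}(v_{(k+1)})<\mathcal{E}(v_{(k)})<\mathcal{E}(v_{(k-2)})<\cd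ots<\mathcal{E}(v_{(3)})<\mathcal{E}(v_{(1)}).$$
   Context: For a graph $G$ with vertices $v_1,\dots,v_n$ and adjacency matrix $A$, the energy of the vertex $v_i$ is $\mathcal{E}_G(v_i)=|A|_{ii}$, the $i$-th diagonal entry of $|A|=(AA^* )^{1/2}$. $P_m$ denotes the path on $m$ vertices. In each chain the indices run first through even numbers in increasing order and then through odd numbers in decreasing order.
   Formalization: In (3) the link E(v_(k)) < E(v_(k+1)) and in (4) the link E(v_(k+1)) < E(v_(k)) are replaced by equality, since reversing the path makes T_(k) and T_(k+1) isomorphic for odd n; all other links stay strict; n ≥ 2 is assumed. *)

theory Defs
  imports
    "Graph_Theory.Pair_Digraph"
    "Jordan_Normal_Form.Schur_Decomposition"
begin

definition psd_mat :: "'a :: conjugatable_ordered_field mat \<Rightarrow> bool" where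
  "psd_mat B \<longleftrightarrow> square_mat B \<and> mat_adjoint B = B \<and>
     (\<forall>v \<in> carrier_vec (dim_row B). 0 \<le> (B *\<^sub>v v) \<bullet>c v)"

text \<open>
  For a square matrix \<open>M\<close>, the operator \<open>M\<^sup>1\<^sup>/\<^sup>2\<close> is the unique positive semidefinite
  square root; it exists, over the reals and over the complex numbers, exactly when \<open>M\<close> is itself
  positive semidefinite, as is the case for \<open>A A\<^sup>*\<close>.
\<close>

definition psd_sqrt :: "'a :: conjugatable_ordered_field mat \<Rightarrow> 'a mat" where
  "psd_sqrt M = (THE B. B \<in> carrier_mat (dim_row M) (dim_col M) \<and> psd_mat B \<and> B * B = M)"

definition mat_abs :: "'a :: conjugatable_ordered_field mat \<Rightarrow> 'a mat" where
  "mat_abs A = psd_sqrt (A * mat_adjoint A)"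

text \<open>
  Graphs are symmetric loop-free digraphs (locale \<open>pair_graph\<close>) with vertex set
  \<open>{1..n}\<close>. Vertex \<open>v\<close> corresponds to row and column \<open>v - 1\<close>, as matrix
  indices start at 0.
\<close>

definition adjacency_mat :: "nat pair_pre_digraph \<Rightarrow> real mat" where
  "adjacency_mat G = mat (card (pverts G)) (card (pverts G))
     (\<lambda>(i, j). if (Suc i, Suc j) \<in> parcs G then 1 else 0)"

definition vertex_energy :: "nat pair_pre_digraph \<Rightarrow> nat \<Rightarrow> real" where
  "vertex_energy G v = mat_abs (adjacency_mat G) $$ (v - 1, v - 1)"

definition path_graph :: "nat \<Rightarrow> nat pair_pre_digraph" where
  "path_graph m = \<lparr> pverts = {1..m},
     parcs = {(u, v). u \<in> {1..m} \<and> v \<in> {1..m} \<and> (v = Suc u \<or> u = Suc v)} \<rparr>"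

text \<open>The tree \<open>T\<^sub>(\<^sub>i\<^sub>)\<close> on \<open>n\<close> vertices; the added vertex is \<open>n\<close>.\<close>

definition pendant_path :: "nat \<Rightarrow> nat \<Rightarrow> nat pair_pre_digraph" where
  "pendant_path n i = \<lparr> pverts = insert n (pverts (path_graph (n - 1))),
     parcs = parcs (path_graph (n - 1)) \<union> {(n, i), (i, n)} \<rparr>"

lemma pverts_pendant_path: "1 \<le> n \<Longrightarrow> pverts (pendant_path n i) = {1..n}"
  by (auto simp: pendant_path_def path_graph_def)

lemma pair_graph_pendant_path:
  assumes "1 \<le> i" "i \<le> n - 1"
  shows "pair_graph (pendant_path n i)"
proof
  show "finite (pverts (pendant_path n i))"
    by (simp add: pendant_path_def path_graph_def)
  show "finite (parcs (pendant_path n i))"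
    by (rule finite_subset[of _ "{1..n} \<times> {1..n}"])
      (use assms in \<open>auto simp: pendant_path_def path_graph_def\<close>)
  show "symmetric (with_proj (pendant_path n i))"
    by (auto simp: symmetric_def sym_def pendant_path_def path_graph_def)
qed (use assms in \<open>auto simp: pendant_path_def path_graph_def\<close>)

definition evens_up_to :: "nat \<Rightarrow> nat list" where
  "evens_up_to m = filter even [1..<Suc m]"

definition odds_down_from :: "nat \<Rightarrow> nat list" where
  "odds_down_from m = rev (filter odd [1..<Suc m])"

definition increasing_along :: "(nat \<Rightarrow> real) \<Rightarrow> nat list \<Rightarrow> bool" where
  "increasing_along f is \<longleftrightarrow> sorted_wrt (<) (map f is)"

end

theory Submission
  imports Defs "Jordan_Normal_Form.Spectral_Radius" "HOL-Real_Asymp.Real_Asymp"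
begin

text \<open>
  The energy of a vertex is a diagonal entry of \<open>\<bar>A\<bar>\<close>, and Coulson's formula
  \<open>\<bar>d\<bar> = 2 / \<pi> \<cdot> \<integral>\<^sub>0\<^sup>\<infinity> d\<^sup>2 / (d\<^sup>2 + y\<^sup>2) dy\<close>, applied to the eigenvalues \<open>d\<close> of \<open>A\<close>, expresses it by
  the imaginary part of the matching diagonal entry of the resolvent \<open>(A + \<i> y)\<^sup>-\<^sup>1\<close>. For the tree \<open>T\<^sub>(\<^sub>i\<^sub>)\<close> and its added vertex
  the resolvent can be written down explicitly: with the Fibonacci polynomials
  \<open>F\<^sub>0 = 0\<close>, \<open>F\<^sub>1 = 1\<close>, \<open>F\<^sub>m\<^sub>+\<^sub>2 = y F\<^sub>m\<^sub>+\<^sub>1 + F\<^sub>m\<close> one obtains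
  \<open>\<E>(v\<^sub>(\<^sub>i\<^sub>)) = 2 / \<pi> \<cdot> \<integral>\<^sub>0\<^sup>\<infinity> q / (y F\<^sub>n + q) dy\<close> with \<open>q = F\<^sub>i F\<^sub>n\<^sub>-\<^sub>i\<close>.

  The integrand is strictly increasing in \<open>q\<close>, and only \<open>q\<close> depends on \<open>i\<close>. Vajda's identity gives
  \<open>F\<^sub>b F\<^sub>n\<^sub>-\<^sub>b - F\<^sub>a F\<^sub>n\<^sub>-\<^sub>a = (-1)\<^sup>a F\<^sub>b\<^sub>-\<^sub>a F\<^sub>n\<^sub>-\<^sub>a\<^sub>-\<^sub>b\<close> for \<open>a < b\<close> and \<open>a + b < n\<close>, so that at every \<open>y > 0\<close>
  an even index \<open>a\<close> lies below, and an odd index \<open>a\<close> above, all larger indices \<open>b\<close> with \<open>a + b < n\<close>.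
  This yields all strict inequalities at once. The equality of the two middle terms for odd \<open>n\<close> holds
  because \<open>q\<close> does not change when \<open>i\<close> is replaced by \<open>n - i\<close>.

  The existence and uniqueness of \<open>\<bar>A\<bar>\<close> come from the spectral theorem
  (\<open>real_spectral_theorem\<close>, \<open>mat_abs_symmetric\<close>). Integrals are replaced by primitives: in
  \<open>mat_abs_diagonal_primitive\<close> a function built from the arctangent starts at \<open>0\<close>, has Coulson's
  integrand as its derivative and tends to \<open>\<pi> / 2\<close> times the entry of \<open>\<bar>A\<bar>\<close>, so that comparing energies
  amounts to comparing derivatives (\<open>limit_less_of_derivative_less\<close>). The explicit resolvent is
  \<open>vertex_energy_pendant_path_primitive\<close>, and the comparison of products is
  \<open>fib_poly_product_less\<close>.
\<close>

section \<open>Orthogonal diagonalisation of real symmetric matrices\<close>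

lemma conjugate_real_vec [simp]: "conjugate (v :: real vec) = v"
  by (rule eq_vecI) auto

lemma scalar_prod_self_nonneg: "v \<bullet> v \<ge> (0 :: real)"
  by (simp add: scalar_prod_def sum_nonneg)

lemma scalar_prod_self_eq_0_iff:
  "v \<in> carrier_vec n \<Longrightarrow> v \<bullet> v = (0 :: real) \<longleftrightarrow> v = 0\<^sub>v n"
  using conjugate_square_eq_0_vec[of v n] by simp

lemma mult_unit_vec:
  "(A :: real mat) \<in> carrier_mat nr nc \<Longrightarrow> j < nc \<Longrightarrow> A *\<^sub>v unit_vec nc j = col A j"
  by (rule eq_vecI) auto

lemma mult_mat_diag_carrier [simp]:
  "A \<in> carrier_mat m n \<Longrightarrow> A * mat_diag n d \<in> carrier_mat m n"
  "A \<in> carrier_mat n m \<Longrightarrow> mat_diag n d * A \<in> carrier_mat n m"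
  by (auto simp: mat_diag_def)

text \<open>
  Over the complex numbers an eigenvector \<open>x + \<i> y\<close> exists. Comparing \<open>(A x) \<bullet> y\<close> with
  \<open>x \<bullet> (A y)\<close> shows that its eigenvalue is real, so that \<open>x\<close> and \<open>y\<close> lie in the same real
  eigenspace and whichever of them is nonzero can be normalised.
\<close>

lemma symmetric_real_mat_eigenvector:
  fixes A :: "real mat"
  assumes A: "A \<in> carrier_mat n n" and sym: "transpose_mat A = A" and "n > 0"
  obtains e v where "v \<in> carrier_vec n" "v \<bullet> v = 1" "A *\<^sub>v v = e \<cdot>\<^sub>v v"
proof -
  note found = that
  define C where "C = map_mat complex_of_real A"
  have C: "C \<in> carrier_mat n n" using A by (simp add: C_def)
  obtain c w where w: "w \<in> carrier_vec n" "w \<noteq> 0\<^sub>v n" "C *\<^sub>v w = c \<cdot>\<^sub>v w"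
    using spectrum_non_empty[OF C \<open>n > 0\<close>] C
    unfolding spectrum_def eigenvalue_def eigenvector_def by auto
  define x y where "x = map_vec Re w" and "y = map_vec Im w"
  have xy: "x \<in> carrier_vec n" "y \<in> carrier_vec n" using w by (auto simp: x_def y_def)
  have row: "(\<Sum>j<n. complex_of_real (A $$ (i, j)) * w $ j) = c * w $ i" if "i < n" for i
    using arg_cong[OF w(3), of "\<lambda>u. u $ i"] that A w(1)
    by (simp add: C_def scalar_prod_def atLeast0LessThan)
  have Ax: "A *\<^sub>v x = Re c \<cdot>\<^sub>v x - Im c \<cdot>\<^sub>v y"
    by (rule eq_vecI)
       (use A xy w row[THEN arg_cong[of _ _ Re]] in \<open>auto simp: x_def y_def scalar_prod_def atLeast0LessThan\<close>)
  have Ay: "A *\<^sub>v y = Im c \<cdot>\<^sub>v x + Re c \<cdot>\<^sub>v y"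
    by (rule eq_vecI)
       (use A xy w row[THEN arg_cong[of _ _ Im]] in \<open>auto simp: x_def y_def scalar_prod_def atLeast0LessThan\<close>)
  have "(A *\<^sub>v x) \<bullet> y = x \<bullet> (A *\<^sub>v y)"
    using transpose_vec_mult_scalar[OF A xy(2) xy(1)] sym xy by simp
  hence "Im c * (x \<bullet> x + y \<bullet> y) = 0"
    unfolding Ax Ay using xy comm_scalar_prod[OF xy]
    by (simp add: minus_scalar_prod_distrib[of _ n] scalar_prod_add_distrib[of _ n] algebra_simps)
  moreover have "x \<bullet> x + y \<bullet> y \<noteq> 0"
  proof
    assume "x \<bullet> x + y \<bullet> y = 0"
    hence "x = 0\<^sub>v n" "y = 0\<^sub>v n"
      using scalar_prod_self_eq_0_iff[OF xy(1)] scalar_prod_self_eq_0_iff[OF xy(2)]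
        scalar_prod_self_nonneg[of x] scalar_prod_self_nonneg[of y] by linarith+
    hence "w = 0\<^sub>v n" using w(1) by (auto simp: x_def y_def vec_eq_iff complex_eq_iff)
    thus False using w by simp
  qed
  ultimately have "Im c = 0" by simp
  hence Ax': "A *\<^sub>v x = Re c \<cdot>\<^sub>v x" and Ay': "A *\<^sub>v y = Re c \<cdot>\<^sub>v y"
    using xy unfolding Ax Ay by (auto intro!: eq_vecI)
  have *: thesis if z: "z \<in> carrier_vec n" "z \<noteq> 0\<^sub>v n" "A *\<^sub>v z = Re c \<cdot>\<^sub>v z" for z
  proof (rule found)
    have "z \<bullet> z > 0" using z scalar_prod_self_nonneg[of z] scalar_prod_self_eq_0_iff[OF z(1)]
      by (auto simp: less_le)
    thus "((1 / sqrt (z \<bullet> z)) \<cdot>\<^sub>v z) \<bullet> ((1 / sqrt (z \<bullet> z)) \<cdot>\<^sub>v z) = 1"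
      using z by simp
    show "A *\<^sub>v ((1 / sqrt (z \<bullet> z)) \<cdot>\<^sub>v z) = Re c \<cdot>\<^sub>v ((1 / sqrt (z \<bullet> z)) \<cdot>\<^sub>v z)"
      using z A by (simp add: mult_mat_vec smult_smult_assoc mult.commute)
  qed (use z in auto)
  show thesis
  proof (cases "x = 0\<^sub>v n")
    case True
    hence "y \<noteq> 0\<^sub>v n" using w by (auto simp: x_def y_def vec_eq_iff complex_eq_iff)
    thus ?thesis using * xy(2) Ay' by blast
  next
    case False
    thus ?thesis using * xy(1) Ax' by blast
  qed
qed

text \<open>
  The matrix is the Householder reflection that exchanges \<open>v\<close> with the first unit vector \<open>e\<^sub>0\<close>, that
  is, the reflection in the hyperplane orthogonal to \<open>w = v - e\<^sub>0\<close>. If \<open>v = e\<^sub>0\<close>, then \<open>w\<close> and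
  \<open>s = w \<bullet> w\<close> are zero, and division by zero turns the formula into the identity matrix.
\<close>

lemma orthogonal_mat_with_first_column:
  fixes v :: "real vec"
  assumes v: "v \<in> carrier_vec n" and unit: "v \<bullet> v = 1" and "n > 0"
  obtains H where "H \<in> carrier_mat n n" "transpose_mat H * H = 1\<^sub>m n" "col H 0 = v"
proof -
  define w where "w = (\<lambda>i. v $ i - (if i = 0 then 1 else 0))"
  define s where "s = (\<Sum>i<n. w i * w i)"
  define H where "H = mat n n (\<lambda>(i, j). (if i = j then 1 else 0) - 2 * w i * w j / s)"
  have vv: "(\<Sum>i<n. v $ i * v $ i) = 1"
    using v unit by (simp add: scalar_prod_def atLeast0LessThan)
  have "s = (\<Sum>i<n. v $ i * v $ i - (if i = 0 then 2 * v $ i - 1 else 0))"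
    unfolding s_def w_def by (rule sum.cong) (auto simp: algebra_simps)
  hence s: "s = 2 - 2 * v $ 0"
    using vv \<open>n > 0\<close> by (simp add: sum_subtractf)
  have w0: "w i = 0" if "s = 0" "i < n" for i
    using that sum_nonneg_eq_0_iff[of "{..<n}" "\<lambda>i. w i * w i"] by (auto simp: s_def)
  show thesis
  proof (rule that)
    show "H \<in> carrier_mat n n" by (simp add: H_def)
    have *: "(\<Sum>k<n. ((if k = i then 1 else 0) - 2 * w k * w i / s) *
              ((if k = j then 1 else 0) - 2 * w k * w j / s)) = (if i = j then 1 else 0)"
      if "i < n" "j < n" for i j
    proof -
      have "(\<Sum>k<n. ((if k = i then 1 else 0) - 2 * w k * w i / s) *
              ((if k = j then 1 else 0) - 2 * w k * w j / s)) =
            (\<Sum>k<n. (if k = i then (if i = j then 1 else 0) - 2 * w i * w j / s else 0)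
               + (if k = j then - 2 * w j * w i / s else 0) + 4 * w i * w j / s\<^sup>2 * (w k * w k))"
        by (rule sum.cong) (auto simp: algebra_simps power2_eq_square)
      also have "\<dots> = (if i = j then 1 else 0) - 4 * w i * w j / s + 4 * w i * w j / s\<^sup>2 * s"
        using that unfolding sum.distrib sum_distrib_left[symmetric] s_def[symmetric] by (simp add: sum.delta)
      finally show ?thesis by (simp add: power2_eq_square)
    qed
    show "transpose_mat H * H = 1\<^sub>m n"
      by (rule eq_matI) (simp_all add: H_def scalar_prod_def atLeast0LessThan *)
    show "col H 0 = v"
    proof (rule eq_vecI)
      fix i assume "i < dim_vec v"
      hence i: "i < n" using v by simp
      show "col H 0 $ i = v $ i"
      proof (cases "s = 0")
        case True
        thus ?thesis using i w0[OF True i] \<open>n > 0\<close> by (auto simp: H_def w_def)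
      next
        case False
        thus ?thesis using i \<open>n > 0\<close> by (auto simp: H_def w_def s field_simps)
      qed
    qed (use v in \<open>simp add: H_def\<close>)
  qed
qed

text \<open>
  Induction on the size: the orthogonal matrix \<open>H\<close> moves the first unit vector to an eigenvector, so
  conjugating by \<open>H\<close> clears the first column and, by symmetry, the first row; the remaining block is
  symmetric and is diagonalised by the induction hypothesis.
\<close>

theorem real_spectral_theorem:
  fixes A :: "real mat"
  assumes "A \<in> carrier_mat n n" "transpose_mat A = A"
  shows "\<exists>U d. U \<in> carrier_mat n n \<and> transpose_mat U * U = 1\<^sub>m n \<and> A * U = U * mat_diag n d"
  using assms
proof (induction n arbitrary: A)
  case 0
  thus ?case by (intro exI[of _ "1\<^sub>m 0"] exI[of _ "\<lambda>_. 0"]) (auto intro!: eq_matI simp: mat_diag_def)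
next
  case (Suc n)
  note A = Suc.prems(1)
  obtain e v where v: "v \<in> carrier_vec (Suc n)" "v \<bullet> v = 1" "A *\<^sub>v v = e \<cdot>\<^sub>v v"
    using symmetric_real_mat_eigenvector[OF Suc.prems] by blast
  obtain H where H: "H \<in> carrier_mat (Suc n) (Suc n)" "transpose_mat H * H = 1\<^sub>m (Suc n)" "col H 0 = v"
    using orthogonal_mat_with_first_column[OF v(1,2)] by auto
  have HT: "transpose_mat H \<in> carrier_mat (Suc n) (Suc n)" using H by simp
  have HH: "H * transpose_mat H = 1\<^sub>m (Suc n)"
    by (rule mat_mult_left_right_inverse[OF HT H(1,2)])
  define B where "B = transpose_mat H * A * H"
  have B: "B \<in> carrier_mat (Suc n) (Suc n)" using A H by (simp add: B_def)
  have Bsym: "transpose_mat B = B"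
    using A H HT Suc.prems(2) unfolding B_def
    by (simp add: transpose_mult[of _ "Suc n" "Suc n" _ "Suc n"] assoc_mult_mat[of _ "Suc n" "Suc n" _ "Suc n" _ "Suc n"])
  have "B *\<^sub>v unit_vec (Suc n) 0 = transpose_mat H *\<^sub>v (A *\<^sub>v (H *\<^sub>v unit_vec (Suc n) 0))"
    using A H HT unfolding B_def
    by (simp add: assoc_mult_mat_vec[of _ "Suc n" "Suc n" _ "Suc n"])
  also have "H *\<^sub>v unit_vec (Suc n) 0 = v"
    using H by (simp add: mult_unit_vec)
  also have "transpose_mat H *\<^sub>v (A *\<^sub>v v) = e \<cdot>\<^sub>v (transpose_mat H *\<^sub>v (H *\<^sub>v unit_vec (Suc n) 0))"
    using v H HT by (simp add: mult_mat_vec mult_unit_vec)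
  also have "transpose_mat H *\<^sub>v (H *\<^sub>v unit_vec (Suc n) 0) = unit_vec (Suc n) 0"
    using H HT by (simp flip: assoc_mult_mat_vec[of _ "Suc n" "Suc n" _ "Suc n"])
  finally have "col B 0 = e \<cdot>\<^sub>v unit_vec (Suc n) 0"
    using B by (simp add: mult_unit_vec)
  hence Bcol: "B $$ (i, 0) = (if i = 0 then e else 0)" if "i < Suc n" for i
  proof -
    have "B $$ (i, 0) = col B 0 $ i" using that B by simp
    thus ?thesis using that \<open>col B 0 = _\<close> by simp
  qed
  have Bflip: "B $$ (i, j) = B $$ (j, i)" if "i < Suc n" "j < Suc n" for i j
    using Bsym that B by (metis carrier_matD index_transpose_mat(1))
  define A' where "A' = mat n n (\<lambda>(i, j). B $$ (Suc i, Suc j))"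
  have "transpose_mat A' = A'"
    by (rule eq_matI) (auto simp: A'_def Bflip)
  then obtain U d where U: "U \<in> carrier_mat n n" "transpose_mat U * U = 1\<^sub>m n"
      "A' * U = U * mat_diag n d"
    using Suc.IH[of A'] by (auto simp: A'_def)
  define V where "V = four_block_mat (1\<^sub>m 1) (0\<^sub>m 1 n) (0\<^sub>m n 1) U"
  define d' where "d' = (\<lambda>i. case i of 0 \<Rightarrow> e | Suc j \<Rightarrow> d j)"
  have A': "A' \<in> carrier_mat n n" by (simp add: A'_def)
  have V: "V \<in> carrier_mat (Suc n) (Suc n)"
    using four_block_carrier_mat[OF one_carrier_mat[of 1] U(1)] unfolding V_def by simp
  have B_block: "B = four_block_mat (mat_diag 1 (\<lambda>_. e)) (0\<^sub>m 1 n) (0\<^sub>m n 1) A'"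
    by (rule eq_matI)
       (use B in \<open>auto simp: A'_def mat_diag_def Bcol Bflip[of 0] less_Suc_eq_0_disj\<close>)
  have d_block: "mat_diag (Suc n) d' = four_block_mat (mat_diag 1 (\<lambda>_. e)) (0\<^sub>m 1 n) (0\<^sub>m n 1) (mat_diag n d)"
    by (rule eq_matI) (auto simp: mat_diag_def d'_def less_Suc_eq_0_disj)
  have BV: "B * V = V * mat_diag (Suc n) d'"
    unfolding B_block V_def d_block using A' U
    by (simp add: mult_four_block_mat[where ?nr1.0=1 and ?n1.0=1 and ?n2.0=n and ?nr2.0=n and ?nc1.0=1 and ?nc2.0=n]
        left_mult_one_mat[OF mat_diag_dim] right_mult_one_mat[OF mat_diag_dim]
        left_mult_zero_mat[OF mat_diag_dim] right_mult_zero_mat[OF mat_diag_dim] del: One_nat_def)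
  have VV: "transpose_mat V * V = 1\<^sub>m (Suc n)"
    using U unfolding V_def
    by (simp add: transpose_four_block_mat[where ?nr1.0=1 and ?nr2.0=n and ?nc1.0=1 and ?nc2.0=n]
        mult_four_block_mat[where ?nr1.0=1 and ?n1.0=1 and ?n2.0=n and ?nr2.0=n and ?nc1.0=1 and ?nc2.0=n])
  note assoc = assoc_mult_mat[of _ "Suc n" "Suc n" _ "Suc n" _ "Suc n"]
  show ?case
  proof (intro exI conjI)
    show "H * V \<in> carrier_mat (Suc n) (Suc n)" using H V by simp
    have "transpose_mat (H * V) * (H * V) = transpose_mat V * (transpose_mat H * H) * V"
      using H V HT transpose_mult[OF H(1) V] assoc[of "transpose_mat V" "transpose_mat H" "H * V"]
        assoc[OF HT H(1) V] assoc[of "transpose_mat V" "transpose_mat H * H" V] by simp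
    thus "transpose_mat (H * V) * (H * V) = 1\<^sub>m (Suc n)"
      using H V VV by simp
    have "A * (H * V) = H * transpose_mat H * A * (H * V)"
      using A H V HH by simp
    also have "\<dots> = H * (B * V)"
      using A H V by (simp add: B_def assoc)
    also have "\<dots> = H * V * mat_diag (Suc n) d'"
      using H V by (simp add: BV assoc)
    finally show "A * (H * V) = H * V * mat_diag (Suc n) d'" .
  qed
qed

section \<open>The absolute value of a real symmetric matrix\<close>

lemma mat_adjoint_real [simp]: "mat_adjoint (A :: real mat) = transpose_mat A"
  by (rule eq_matI) (simp_all add: mat_adjoint_def mat_of_rows_def)

lemma diagonal_congruence_entry:
  fixes U :: "real mat"
  assumes "U \<in> carrier_mat n n" "i < n" "j < n"
  shows "(U * mat_diag n d * transpose_mat U) $$ (i, j) = (\<Sum>l<n. d l * U $$ (i, l) * U $$ (j, l))"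
  using assms by (simp add: mat_diag_mult_right[OF assms(1)] scalar_prod_def atLeast0LessThan mult_ac)

lemma transpose_mat_diag [simp]: "transpose_mat (mat_diag n d) = mat_diag n d"
  by (rule eq_matI) (auto simp: mat_diag_def)

lemma psd_mat_diagonal_congruence:
  fixes U :: "real mat"
  assumes U: "U \<in> carrier_mat n n" and d: "\<And>l. l < n \<Longrightarrow> d l \<ge> 0"
  shows "psd_mat (U * mat_diag n d * transpose_mat U)"
  unfolding psd_mat_def
proof (intro conjI ballI)
  have UT: "transpose_mat U \<in> carrier_mat n n" using U by simp
  note assoc = assoc_mult_mat[of _ n n _ n _ n]
  show "square_mat (U * mat_diag n d * transpose_mat U)" using U by simp
  show "mat_adjoint (U * mat_diag n d * transpose_mat U) = U * mat_diag n d * transpose_mat U"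
    using U UT
    by (simp add: transpose_mult[of _ n n _ n] assoc)
  fix v :: "real vec" assume "v \<in> carrier_vec (dim_row (U * mat_diag n d * transpose_mat U))"
  hence v: "v \<in> carrier_vec n" using U by simp
  define w where "w = transpose_mat U *\<^sub>v v"
  have w: "w \<in> carrier_vec n" using UT v unfolding w_def by (rule mult_mat_vec_carrier)
  have "(U * mat_diag n d * transpose_mat U) *\<^sub>v v = U *\<^sub>v (mat_diag n d *\<^sub>v w)"
    using U UT v by (simp add: w_def assoc assoc_mult_mat_vec[of _ n n _ n])
  also have "(U *\<^sub>v (mat_diag n d *\<^sub>v w)) \<bullet> v = (mat_diag n d *\<^sub>v w) \<bullet> w"
    using transpose_vec_mult_scalar[OF UT, of v "mat_diag n d *\<^sub>v w"] v w
      mult_mat_vec_carrier[OF mat_diag_dim w, of d] by (simp add: w_def)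
  also have "\<dots> = (\<Sum>l<n. d l * w $ l * w $ l)"
  proof -
    have "(mat_diag n d *\<^sub>v w) $ l = d l * w $ l" if "l < n" for l
      using that w by (simp add: mat_diag_def scalar_prod_def atLeast0LessThan if_distrib[of "\<lambda>x. x * _"] sum.delta cong: if_cong)
    thus ?thesis using w by (simp add: scalar_prod_def atLeast0LessThan)
  qed
  also have "\<dots> \<ge> 0" by (intro sum_nonneg) (simp add: d mult.assoc)
  finally show "0 \<le> ((U * mat_diag n d * transpose_mat U) *\<^sub>v v) \<bullet>c v" by simp
qed

lemma psd_mat_diagonal_nonneg:
  fixes B V :: "real mat"
  assumes B: "B \<in> carrier_mat n n" "psd_mat B" and V: "V \<in> carrier_mat n n" "transpose_mat V * V = 1\<^sub>m n"
    and BV: "B * V = V * mat_diag n e" and l: "l < n"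
  shows "e l \<ge> 0"
proof -
  define c where "c = col V l"
  have c: "c \<in> carrier_vec n" using V l by (simp add: c_def)
  have "B *\<^sub>v c = col (B * V) l" using B V l by (auto simp: c_def)
  also have "\<dots> = e l \<cdot>\<^sub>v c"
    using V l unfolding BV by (auto simp: mat_diag_mult_right[OF V(1)] c_def)
  finally have "(B *\<^sub>v c) \<bullet> c = e l * (c \<bullet> c)" using c by simp
  also have "c \<bullet> c = (transpose_mat V * V) $$ (l, l)" using V(1) l by (simp add: c_def)
  finally have "(B *\<^sub>v c) \<bullet> c = e l" using V l by simp
  moreover have "0 \<le> (B *\<^sub>v c) \<bullet> c" using B c unfolding psd_mat_def by fastforce
  ultimately show ?thesis by simp
qed

text \<open>
  If \<open>V\<close> diagonalises \<open>B\<close> with eigenvalues \<open>e\<close>, the matrix \<open>W = V\<^sup>T U\<close> intertwines \<open>e\<^sup>2\<close> with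
  \<open>d\<^sup>2\<close>: its entry \<open>(i, j)\<close> vanishes unless \<open>e\<^sub>i\<^sup>2 = d\<^sub>j\<^sup>2\<close>. As \<open>e\<close> and \<open>d\<close> are nonnegative, this is
  the same as \<open>e\<^sub>i = d\<^sub>j\<close>, so \<open>W\<close> intertwines \<open>e\<close> with \<open>d\<close> as well, and translating back gives
  \<open>B U = U d\<close>.
\<close>

lemma psd_mat_sqrt_unique:
  fixes B U :: "real mat"
  assumes B: "B \<in> carrier_mat n n" "psd_mat B"
    and U: "U \<in> carrier_mat n n" "transpose_mat U * U = 1\<^sub>m n" and d: "\<And>l. l < n \<Longrightarrow> d l \<ge> 0"
    and sq: "B * B * U = U * mat_diag n (\<lambda>l. d l * d l)"
  shows "B = U * mat_diag n d * transpose_mat U"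
proof -
  have UT: "transpose_mat U \<in> carrier_mat n n" using U by simp
  have UU: "U * transpose_mat U = 1\<^sub>m n" by (rule mat_mult_left_right_inverse[OF UT U])
  have "transpose_mat B = B" using B by (simp add: psd_mat_def)
  then obtain V e where V: "V \<in> carrier_mat n n" "transpose_mat V * V = 1\<^sub>m n" 
      and BV: "B * V = V * mat_diag n e"
    using real_spectral_theorem[OF B(1)] by blast
  have VT: "transpose_mat V \<in> carrier_mat n n" using V by simp
  have VV: "V * transpose_mat V = 1\<^sub>m n" by (rule mat_mult_left_right_inverse[OF VT V])
  have e: "e l \<ge> 0" if "l < n" for l
    by (rule psd_mat_diagonal_nonneg[OF B V BV that])
  note assoc = assoc_mult_mat[of _ n n _ n _ n]
  define W where "W = transpose_mat V * U"
  have W: "W \<in> carrier_mat n n" using U VT by (simp add: W_def)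
  have U_eq: "U = V * W" using U V VT VV by (simp add: W_def flip: assoc)
  have VB: "transpose_mat V * B = mat_diag n e * transpose_mat V"
    using arg_cong[OF BV, of transpose_mat] transpose_mult[OF B(1) V(1)]
      transpose_mult[OF V(1) mat_diag_dim] \<open>transpose_mat B = B\<close> by simp
  have "mat_diag n (\<lambda>l. e l * e l) * W = mat_diag n e * (mat_diag n e * W)"
    using assoc[OF mat_diag_dim mat_diag_dim W] by simp
  also have "mat_diag n e * W = transpose_mat V * (B * U)"
    unfolding W_def assoc[OF mat_diag_dim VT U(1), symmetric] VB[symmetric]
    by (rule assoc[OF VT B(1) U(1)])
  also have "mat_diag n e * \<dots> = transpose_mat V * (B * B * U)"
    using B V VT U assoc[OF mat_diag_dim VT, of "B * U" e] assoc[OF VT B(1), of "B * U"] assoc[OF B(1) B(1) U(1)]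
    by (simp add: VB)
  also have "\<dots> = W * mat_diag n (\<lambda>l. d l * d l)"
    unfolding sq W_def using assoc[OF VT U(1) mat_diag_dim] by simp
  finally have eq: "mat_diag n (\<lambda>l. e l * e l) * W = W * mat_diag n (\<lambda>l. d l * d l)" .
  have "mat_diag n e * W = W * mat_diag n d"
  proof (rule eq_matI)
    fix i j assume "i < dim_row (W * mat_diag n d)" "j < dim_col (W * mat_diag n d)"
    hence ij: "i < n" "j < n" using W by (auto simp: mat_diag_def)
    have "e i * e i * W $$ (i, j) = W $$ (i, j) * (d j * d j)"
      using arg_cong[OF eq, of "\<lambda>M. M $$ (i, j)"] ij
      by (simp add: mat_diag_mult_left[OF W] mat_diag_mult_right[OF W])
    hence "W $$ (i, j) = 0 \<or> e i * e i = d j * d j" by auto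
    hence "W $$ (i, j) = 0 \<or> e i = d j"
      using e[OF ij(1)] d[OF ij(2)] by (simp add: power2_eq_iff_nonneg flip: power2_eq_square)
    thus "(mat_diag n e * W) $$ (i, j) = (W * mat_diag n d) $$ (i, j)"
      using ij by (auto simp: mat_diag_mult_left[OF W] mat_diag_mult_right[OF W])
  qed (use W in \<open>auto simp: mat_diag_def\<close>)
  hence "B * U = U * mat_diag n d"
    using B V W unfolding U_eq by (simp add: assoc[OF V(1) W] assoc[OF B(1) V(1) W, symmetric] BV assoc[OF V(1)])
  hence "U * mat_diag n d * transpose_mat U = B * (U * transpose_mat U)"
    using assoc[OF B(1) U(1) UT] by simp
  thus ?thesis using B UU by simp
qed

theorem mat_abs_symmetric:
  fixes A U :: "real mat"
  assumes A: "A \<in> carrier_mat n n" "transpose_mat A = A"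
    and U: "U \<in> carrier_mat n n" "transpose_mat U * U = 1\<^sub>m n" and AU: "A * U = U * mat_diag n d"
  shows "mat_abs A = U * mat_diag n (\<lambda>l. \<bar>d l\<bar>) * transpose_mat U"
proof -
  let ?B = "U * mat_diag n (\<lambda>l. \<bar>d l\<bar>) * transpose_mat U"
  note assoc = assoc_mult_mat[of _ n n _ n _ n]
  have UT: "transpose_mat U \<in> carrier_mat n n" using U by simp
  have UU: "U * transpose_mat U = 1\<^sub>m n" by (rule mat_mult_left_right_inverse[OF UT U])
  have AAU: "A * A * U = U * mat_diag n (\<lambda>l. d l * d l)"
  proof -
    have "A * A * U = A * (U * mat_diag n d)" using assoc[OF A(1) A(1) U(1)] by (simp add: AU)
    also have "\<dots> = U * mat_diag n d * mat_diag n d"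
      using assoc[OF A(1) U(1) mat_diag_dim[of n d]] by (simp add: AU)
    also have "\<dots> = U * mat_diag n (\<lambda>l. d l * d l)"
      using assoc[OF U(1) mat_diag_dim mat_diag_dim] by simp
    finally show ?thesis .
  qed
  have BU: "?B * U = U * mat_diag n (\<lambda>l. \<bar>d l\<bar>)"
    using assoc[of "U * mat_diag n (\<lambda>l. \<bar>d l\<bar>)", OF _ UT U(1)] U
      right_mult_one_mat[OF mult_mat_diag_carrier(1)[OF U(1)]] by simp
  have B: "?B \<in> carrier_mat n n"
    by (rule mult_carrier_mat[OF mult_mat_diag_carrier(1)[OF U(1)] UT])
  have "?B * ?B * U = ?B * U * mat_diag n (\<lambda>l. \<bar>d l\<bar>)"
    using B U assoc[OF B B U(1)] assoc[OF B U(1) mat_diag_dim] by (simp add: BU)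
  also have "\<dots> = A * A * U"
    using assoc[OF U(1) mat_diag_dim mat_diag_dim] unfolding BU AAU by simp
  finally have "?B * ?B * (U * transpose_mat U) = A * A * (U * transpose_mat U)"
    using B A U UT assoc[of "?B * ?B", OF _ U(1) UT] assoc[of "A * A", OF _ U(1) UT] by simp
  hence BB: "?B * ?B = A * A"
    using right_mult_one_mat[OF mult_carrier_mat[OF B B]] A unfolding UU by simp
  show ?thesis
    unfolding mat_abs_def psd_sqrt_def mat_adjoint_real A(2)
  proof (rule the_equality, intro conjI)
    show "?B \<in> carrier_mat (dim_row (A * A)) (dim_col (A * A))" using A B by simp
    show "psd_mat ?B" by (rule psd_mat_diagonal_congruence[OF U(1)]) simp
    show "?B * ?B = A * A" by (rule BB)
    fix C assume "C \<in> carrier_mat (dim_row (A * A)) (dim_col (A * A)) \<and> psd_mat C \<and> C * C = A * A"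
    thus "C = ?B"
      using A AAU by (intro psd_mat_sqrt_unique[OF _ _ U]) simp_all
  qed
qed

section \<open>Diagonal entries of the absolute value and the resolvent\<close>

text \<open>
  The vector \<open>u\<close> is column \<open>v\<close> of \<open>(A + \<i> y)\<^sup>-\<^sup>1\<close>. Stating this as a linear system keeps matrix
  inversion out of the argument and lets a solution be verified entry by entry.
\<close>

definition resolvent_column :: "real mat \<Rightarrow> nat \<Rightarrow> real \<Rightarrow> (nat \<Rightarrow> complex) \<Rightarrow> bool" where
  "resolvent_column A v y u \<longleftrightarrow> (\<forall>i<dim_row A.
     (\<Sum>j<dim_col A. of_real (A $$ (i, j)) * u j) + \<i> * of_real y * u i = (if i = v then 1 else 0))"

text \<open>
  This is Coulson's formula in terms of a primitive. For one eigenvalue, \<open>\<bar>d\<bar> arctan (y / \<bar>d\<bar>)\<close>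
  vanishes at \<open>0\<close>, tends to \<open>\<pi> / 2 \<cdot> \<bar>d\<bar>\<close>, and has derivative
  \<open>d\<^sup>2 / (d\<^sup>2 + y\<^sup>2) = 1 - y\<^sup>2 / (d\<^sup>2 + y\<^sup>2)\<close>, in which \<open>- y / (d\<^sup>2 + y\<^sup>2)\<close> is the imaginary part of
  \<open>1 / (d + \<i> y)\<close>. Adding these up with the weights \<open>U\<^sub>v\<^sub>l\<^sup>2\<close>, whose sum is \<open>1\<close>, turns the limit
  into a diagonal entry of \<open>\<bar>A\<bar>\<close> and the derivative into a diagonal entry of the resolvent.
\<close>

lemma mat_abs_diagonal_primitive:
  fixes A :: "real mat"
  assumes A: "A \<in> carrier_mat n n" "transpose_mat A = A" and v: "v < n"
  obtains \<Phi> where "\<Phi> 0 = 0" "continuous_on {0..} \<Phi>"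
    "(\<Phi> \<longlongrightarrow> pi / 2 * mat_abs A $$ (v, v)) at_top"
    "\<And>y u. y > 0 \<Longrightarrow> resolvent_column A v y u \<Longrightarrow> (\<Phi> has_real_derivative 1 + y * Im (u v)) (at y)"
proof -
  obtain U d where U: "U \<in> carrier_mat n n" "transpose_mat U * U = 1\<^sub>m n"
      and AU: "A * U = U * mat_diag n d"
    using real_spectral_theorem[OF A] by blast
  define w where "w = (\<lambda>l. U $$ (v, l) * U $$ (v, l))"
  define \<Phi> where "\<Phi> = (\<lambda>y. \<Sum>l<n. w l * (\<bar>d l\<bar> * arctan (y / \<bar>d l\<bar>)))"
  have UT: "transpose_mat U \<in> carrier_mat n n" using U by simp
  have UU: "U * transpose_mat U = 1\<^sub>m n" by (rule mat_mult_left_right_inverse[OF UT U])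
  have w1: "(\<Sum>l<n. w l) = 1"
    using arg_cong[OF UU, of "\<lambda>M. M $$ (v, v)"] U v
    by (simp add: w_def scalar_prod_def atLeast0LessThan)
  have eig: "(\<Sum>i<n. A $$ (i, j) * U $$ (i, l)) = d l * U $$ (j, l)" if "j < n" "l < n" for j l
  proof -
    have "A $$ (i, j) = A $$ (j, i)" if "i < n" for i
      using A that \<open>j < n\<close> by (metis carrier_matD index_transpose_mat(1))
    hence "(\<Sum>i<n. A $$ (i, j) * U $$ (i, l)) = (A * U) $$ (j, l)"
      using A U that by (simp add: scalar_prod_def atLeast0LessThan)
    thus ?thesis using U that by (simp add: AU mat_diag_mult_right[OF U(1)])
  qed
  show thesis
  proof (rule that)
    show "\<Phi> 0 = 0" by (simp add: \<Phi>_def)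
    show "continuous_on {0..} \<Phi>"
      unfolding \<Phi>_def divide_inverse by (intro continuous_intros)
    have "((\<lambda>y. \<bar>d l\<bar> * arctan (y / \<bar>d l\<bar>)) \<longlongrightarrow> \<bar>d l\<bar> * (pi / 2)) at_top" for l
    proof (cases "d l = 0")
      case False
      have "filterlim (\<lambda>y. y / \<bar>d l\<bar>) at_top at_top"
        using False by real_asymp
      thus ?thesis
        by (intro tendsto_mult tendsto_const filterlim_compose[OF tendsto_arctan_at_top])
    qed auto
    hence "(\<Phi> \<longlongrightarrow> (\<Sum>l<n. w l * (\<bar>d l\<bar> * (pi / 2)))) at_top"
      unfolding \<Phi>_def by (rule tendsto_sum[OF tendsto_mult_left])
    also have "(\<Sum>l<n. w l * (\<bar>d l\<bar> * (pi / 2))) = pi / 2 * mat_abs A $$ (v, v)"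
      unfolding mat_abs_symmetric[OF A U AU] diagonal_congruence_entry[OF U(1) v v] sum_distrib_left
      by (rule sum.cong) (auto simp: w_def)
    finally show "(\<Phi> \<longlongrightarrow> pi / 2 * mat_abs A $$ (v, v)) at_top" .
  next
    fix y :: real and u :: "nat \<Rightarrow> complex"
    assume y: "y > 0" and "resolvent_column A v y u"
    hence res: "(\<Sum>j<n. of_real (A $$ (i, j)) * u j) + \<i> * of_real y * u i = (if i = v then 1 else 0)"
      if "i < n" for i
      using that A by (auto simp: resolvent_column_def)
    define c where "c = (\<lambda>l. \<Sum>j<n. of_real (U $$ (j, l)) * u j)"
    \<comment> \<open>\<open>c l\<close> is the coordinate of \<open>u\<close> along the eigenvector in column \<open>l\<close> of \<open>U\<close>.\<close>
    have c: "(of_real (d l) + \<i> * of_real y) * c l = of_real (U $$ (v, l))" if l: "l < n" for l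
    proof -
      have "of_real (U $$ (v, l)) = (\<Sum>i<n. of_real (U $$ (i, l)) * (if i = v then 1 else 0 :: complex))"
        using v by (simp add: sum.delta' if_distrib[of "(*) _"] cong: if_cong)
      also have "\<dots> = (\<Sum>i<n. of_real (U $$ (i, l)) *
          ((\<Sum>j<n. of_real (A $$ (i, j)) * u j) + \<i> * of_real y * u i))"
        by (intro sum.cong) (simp_all add: res)
      also have "\<dots> = (\<Sum>i<n. \<Sum>j<n. of_real (A $$ (i, j) * U $$ (i, l)) * u j) + \<i> * of_real y * c l"
        by (simp add: c_def distrib_left sum.distrib sum_distrib_left mult_ac)
      also have "(\<Sum>i<n. \<Sum>j<n. of_real (A $$ (i, j) * U $$ (i, l)) * u j)
          = (\<Sum>j<n. of_real (\<Sum>i<n. A $$ (i, j) * U $$ (i, l)) * u j)"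
        by (subst sum.swap) (simp add: sum_distrib_right)
      also have "\<dots> = of_real (d l) * c l"
        using l by (simp add: eig c_def sum_distrib_left mult_ac)
      finally show ?thesis by (simp add: algebra_simps)
    qed
    have "u v = (\<Sum>j<n. of_real ((U * transpose_mat U) $$ (v, j)) * u j)"
      using v unfolding UU by (simp add: if_distrib[of of_real] if_distrib[of "\<lambda>x. x * _"] sum.delta' cong: if_cong)
    also have "\<dots> = (\<Sum>j<n. \<Sum>l<n. of_real (U $$ (v, l) * U $$ (j, l)) * u j)"
      using U v by (simp add: scalar_prod_def atLeast0LessThan sum_distrib_right)
    also have "\<dots> = (\<Sum>l<n. of_real (U $$ (v, l)) * c l)"
      by (subst sum.swap) (simp add: c_def sum_distrib_left mult_ac)
    also have "\<dots> = (\<Sum>l<n. of_real (w l) / (of_real (d l) + \<i> * of_real y))"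
    proof (rule sum.cong)
      fix l assume "l \<in> {..<n}"
      moreover have "complex_of_real (d l) + \<i> * of_real y \<noteq> 0" using y by (auto simp: complex_eq_iff)
      ultimately show "of_real (U $$ (v, l)) * c l = of_real (w l) / (of_real (d l) + \<i> * of_real y)"
        using c[of l] by (auto simp: w_def nonzero_eq_divide_eq mult_ac)
    qed simp
    finally have "Im (u v) = (\<Sum>l<n. - (w l * y / ((d l)\<^sup>2 + y\<^sup>2)))"
      by (simp add: Im_divide)
    hence "1 + y * Im (u v) = (\<Sum>l<n. w l - w l * y\<^sup>2 / ((d l)\<^sup>2 + y\<^sup>2))"
      by (simp add: w1 sum_subtractf sum_distrib_left sum_negf power2_eq_square mult_ac)
    also have "\<dots> = (\<Sum>l<n. w l * ((d l)\<^sup>2 / ((d l)\<^sup>2 + y\<^sup>2)))"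
    proof (rule sum.cong)
      fix l
      have "(d l)\<^sup>2 + y\<^sup>2 > 0" using y by (simp add: add_nonneg_pos)
      hence "(d l)\<^sup>2 / ((d l)\<^sup>2 + y\<^sup>2) = 1 - y\<^sup>2 / ((d l)\<^sup>2 + y\<^sup>2)"
        using y by (simp add: eq_diff_eq flip: add_divide_distrib)
      thus "w l - w l * y\<^sup>2 / ((d l)\<^sup>2 + y\<^sup>2) = w l * ((d l)\<^sup>2 / ((d l)\<^sup>2 + y\<^sup>2))"
        by (simp add: right_diff_distrib)
    qed simp
    finally have eq: "1 + y * Im (u v) = (\<Sum>l<n. w l * ((d l)\<^sup>2 / ((d l)\<^sup>2 + y\<^sup>2)))" .
    have "((\<lambda>y. \<bar>d l\<bar> * arctan (y / \<bar>d l\<bar>)) has_real_derivative (d l)\<^sup>2 / ((d l)\<^sup>2 + y\<^sup>2)) (at y)" for l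
    proof (cases "d l = 0")
      case False
      have "((\<lambda>y. \<bar>d l\<bar> * arctan (y / \<bar>d l\<bar>)) has_real_derivative
          \<bar>d l\<bar> * (inverse (1 + (y / \<bar>d l\<bar>)\<^sup>2) * (1 / \<bar>d l\<bar>))) (at y)"
        using False by (auto intro!: derivative_eq_intros simp: mult.assoc)
      also have "\<bar>d l\<bar> * (inverse (1 + (y / \<bar>d l\<bar>)\<^sup>2) * (1 / \<bar>d l\<bar>)) = (d l)\<^sup>2 / ((d l)\<^sup>2 + y\<^sup>2)"
      proof -
        have "1 + (y / \<bar>d l\<bar>)\<^sup>2 = ((d l)\<^sup>2 + y\<^sup>2) / (d l)\<^sup>2"
          using False by (simp add: field_simps)
        thus ?thesis using False by simp
      qed
      finally show ?thesis .
    qed auto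
    thus "(\<Phi> has_real_derivative 1 + y * Im (u v)) (at y)"
      unfolding eq \<Phi>_def by (intro DERIV_sum DERIV_cmult)
  qed
qed

text \<open>
  The difference \<open>g - f\<close> starts at \<open>0\<close> and is strictly increasing, so its limit is at least its
  value at \<open>1\<close>, which is positive.
\<close>

lemma limit_less_of_derivative_less:
  fixes f g :: "real \<Rightarrow> real"
  assumes "f 0 = 0" "g 0 = 0" "continuous_on {0..} f" "continuous_on {0..} g"
    and lim: "(f \<longlongrightarrow> a) at_top" "(g \<longlongrightarrow> b) at_top"
    and der: "\<And>y. y > 0 \<Longrightarrow> (f has_real_derivative f' y) (at y)"
      "\<And>y. y > 0 \<Longrightarrow> (g has_real_derivative g' y) (at y)"
    and less: "\<And>y. y > 0 \<Longrightarrow> f' y < g' y"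
  shows "a < b"
proof -
  define h where "h = (\<lambda>y. g y - f y)"
  have incr: "h x < h z" if "0 \<le> x" "x < z" for x z
  proof (rule DERIV_pos_imp_increasing_open[OF \<open>x < z\<close>])
    fix y assume "x < y"
    hence "y > 0" using that by simp
    thus "\<exists>D. (h has_real_derivative D) (at y) \<and> 0 < D"
      unfolding h_def using DERIV_diff[OF der(2) der(1)] less by (auto intro!: exI[of _ "g' y - f' y"])
  next
    show "continuous_on {x..z} h"
      unfolding h_def using that assms(3,4)
      by (intro continuous_intros) (auto elim: continuous_on_subset)
  qed
  have "h 1 \<le> b - a"
  proof (rule tendsto_lowerbound)
    show "(h \<longlongrightarrow> b - a) at_top" unfolding h_def by (intro tendsto_diff lim)
    show "\<forall>\<^sub>F y in at_top. h 1 \<le> h y"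
      using eventually_gt_at_top[of 1] by eventually_elim (use incr[of 1] in \<open>auto intro: less_imp_le\<close>)
  qed simp
  moreover have "h 0 < h 1" by (rule incr) auto
  ultimately show ?thesis using assms(1,2) by (simp add: h_def)
qed

lemma limit_eq_of_derivative_eq:
  fixes f g :: "real \<Rightarrow> real"
  assumes "f 0 = 0" "g 0 = 0" "continuous_on {0..} f" "continuous_on {0..} g"
    and lim: "(f \<longlongrightarrow> a) at_top" "(g \<longlongrightarrow> b) at_top"
    and der: "\<And>y. y > 0 \<Longrightarrow> (f has_real_derivative f' y) (at y)"
      "\<And>y. y > 0 \<Longrightarrow> (g has_real_derivative f' y) (at y)"
  shows "a = b"
proof -
  define h where "h = (\<lambda>y. g y - f y)"
  have "h y = 0" if "y > 0" for y
  proof -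
    have "h y = h 0"
    proof (rule DERIV_isconst2[of 0 y])
      show "continuous_on {0..y} h"
        unfolding h_def using assms(3,4)
        by (intro continuous_intros) (auto elim: continuous_on_subset)
      show "(h has_real_derivative 0) (at x)" if "0 < x" "x < y" for x
        unfolding h_def using DERIV_diff[OF der(2)[OF \<open>0 < x\<close>] der(1)[OF \<open>0 < x\<close>]] by simp
    qed (use that in auto)
    thus ?thesis using assms(1,2) by (simp add: h_def)
  qed
  hence "(h \<longlongrightarrow> 0) at_top"
    by (intro tendsto_eventually eventually_at_top_linorderI[of 1]) auto
  moreover have "(h \<longlongrightarrow> b - a) at_top" unfolding h_def by (intro tendsto_diff lim)
  ultimately have "b - a = 0" using tendsto_unique[of at_top h "b - a" 0] by simp
  thus ?thesis by simp
qed

section \<open>Fibonacci polynomials\<close>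

text \<open>
  These are the Fibonacci polynomials. Up to powers of \<open>\<i>\<close>, \<open>fib_poly y (m + 1)\<close> is the
  characteristic polynomial of the path on \<open>m\<close> vertices at \<open>\<i> y\<close>; the index is shifted so that the
  value at \<open>0\<close> vanishes, which encodes the ends of a path.
\<close>

fun fib_poly :: "real \<Rightarrow> nat \<Rightarrow> real" where
  "fib_poly y 0 = 0"
| "fib_poly y (Suc 0) = 1"
| "fib_poly y (Suc (Suc m)) = y * fib_poly y (Suc m) + fib_poly y m"

lemma fib_poly_nonneg: "y > 0 \<Longrightarrow> fib_poly y m \<ge> 0"
  by (induction y m rule: fib_poly.induct) auto

lemma fib_poly_pos: "y > 0 \<Longrightarrow> m > 0 \<Longrightarrow> fib_poly y m > 0"
  by (induction y m rule: fib_poly.induct) (auto intro!: add_pos_nonneg fib_poly_nonneg)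

lemma fib_poly_add:
  "fib_poly y (Suc (m + n)) = fib_poly y (Suc m) * fib_poly y (Suc n) + fib_poly y m * fib_poly y n"
proof (induction y n rule: fib_poly.induct)
  case (3 y n)
  have "fib_poly y (Suc (m + Suc (Suc n))) = y * fib_poly y (Suc (m + Suc n)) + fib_poly y (Suc (m + n))"
    by simp
  also have "\<dots> = fib_poly y (Suc m) * fib_poly y (Suc (Suc (Suc n))) + fib_poly y m * fib_poly y (Suc (Suc n))"
    unfolding 3 by (simp add: algebra_simps)
  finally show ?case .
qed simp_all

text \<open>
  By the addition formula, either product on the left, added to its successor with \<open>p + 1\<close> in place of
  \<open>p\<close>, gives the value with index \<open>2 p + a + b + 1\<close>. So the difference only changes its sign when
  \<open>p\<close> grows by one, and for \<open>p = 0\<close> it is the product on the right.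
\<close>

lemma fib_poly_vajda:
  "fib_poly y (p + a) * fib_poly y (p + b) - fib_poly y p * fib_poly y (p + a + b)
     = (- 1) ^ p * fib_poly y a * fib_poly y b"
proof (induction p)
  case (Suc p)
  have "fib_poly y (Suc (p + a)) * fib_poly y (Suc (p + b)) + fib_poly y (p + a) * fib_poly y (p + b)
      = fib_poly y (Suc p) * fib_poly y (Suc (p + a + b)) + fib_poly y p * fib_poly y (p + a + b)"
    using fib_poly_add[of y "p + a" "p + b"] fib_poly_add[of y p "p + a + b"]
    by (metis add.left_commute)
  thus ?case using Suc.IH by simp
qed simp

text \<open>
  By Vajda's identity the two products differ by the product of two positive values, with a sign given by
  the parity of the smaller index \<open>a\<close>. This sign is the origin of the even/odd pattern of the chains.
\<close>

lemma fib_poly_product_less: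
  assumes "y > 0" "a < b" "a + b < n"
  shows "even a \<Longrightarrow> fib_poly y a * fib_poly y (n - a) < fib_poly y b * fib_poly y (n - b)"
    and "odd a \<Longrightarrow> fib_poly y b * fib_poly y (n - b) < fib_poly y a * fib_poly y (n - a)"
proof -
  have "fib_poly y b * fib_poly y (n - b) - fib_poly y a * fib_poly y (n - a)
      = (- 1) ^ a * fib_poly y (b - a) * fib_poly y (n - a - b)"
    using fib_poly_vajda[of y a "b - a" "n - a - b"] assms by simp
  moreover have "fib_poly y (b - a) * fib_poly y (n - a - b) > 0"
    using assms by (simp add: fib_poly_pos)
  ultimately show "even a \<Longrightarrow> fib_poly y a * fib_poly y (n - a) < fib_poly y b * fib_poly y (n - b)"
    and "odd a \<Longrightarrow> fib_poly y b * fib_poly y (n - b) < fib_poly y a * fib_poly y (n - a)"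
    by auto
qed

section \<open>The resolvent of a path with a pendant vertex\<close>

lemma adjacency_mat_pendant_path:
  assumes "1 \<le> i" "i < n"
  shows "adjacency_mat (pendant_path n i) \<in> carrier_mat n n"
    "transpose_mat (adjacency_mat (pendant_path n i)) = adjacency_mat (pendant_path n i)"
    "\<And>j k. j < n \<Longrightarrow> k < n \<Longrightarrow> adjacency_mat (pendant_path n i) $$ (j, k) =
       (if (Suc j, Suc k) \<in> parcs (pendant_path n i) then 1 else 0)"
proof -
  have "card (pverts (pendant_path n i)) = n"
    using assms by (simp add: pverts_pendant_path)
  thus carrier: "adjacency_mat (pendant_path n i) \<in> carrier_mat n n"
    and entry: "\<And>j k. j < n \<Longrightarrow> k < n \<Longrightarrow> adjacency_mat (pendant_path n i) $$ (j, k) =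
       (if (Suc j, Suc k) \<in> parcs (pendant_path n i) then 1 else 0)"
    by (simp_all add: adjacency_mat_def)
  show "transpose_mat (adjacency_mat (pendant_path n i)) = adjacency_mat (pendant_path n i)"
    by (rule eq_matI) (use carrier entry in \<open>auto simp: pendant_path_def path_graph_def\<close>)
qed

text \<open>
  Because \<open>w\<close> vanishes at \<open>0\<close> and \<open>n\<close>, the end vertices of the path obey the same formula as the
  inner ones. The value \<open>z\<close> at the added vertex \<open>n\<close> is kept apart, since position \<open>n\<close> serves at the
  same time as the fictitious right neighbour of the last path vertex.
\<close>

lemma pendant_path_neighbour_sum:
  fixes w :: "nat \<Rightarrow> complex"
  assumes i: "1 \<le> i" "i < n" and w: "w 0 = 0" "w n = 0" and j: "1 \<le> j" "j \<le> n"
  shows "(\<Sum>k<n. (if (j, Suc k) \<in> parcs (pendant_path n i) then 1 else 0) * (w(n := z)) (Suc k)) =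
    (if j = n then w i else w (j - 1) + w (j + 1) + (if j = i then z else 0))"
proof -
  have "(\<Sum>k<n. (if (j, Suc k) \<in> parcs (pendant_path n i) then 1 else 0) * (w(n := z)) (Suc k)) =
    (\<Sum>k\<in>{1..n}. (if (j, k) \<in> parcs (pendant_path n i) then 1 else 0) * (w(n := z)) k)"
    by (rule sum.reindex_bij_witness[of _ "\<lambda>k. k - 1" Suc]) auto
  also have "\<dots> = (if j = n then w i else w (j - 1) + w (j + 1) + (if j = i then z else 0))"
  proof (cases "j = n")
    case True
    have "(j, k) \<in> parcs (pendant_path n i) \<longleftrightarrow> k = i" for k
      unfolding True using i by (auto simp: pendant_path_def path_graph_def)
    hence "(\<Sum>k\<in>{1..n}. (if (j, k) \<in> parcs (pendant_path n i) then 1 else 0) * (w(n := z)) k)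
        = (\<Sum>k\<in>{1..n}. if k = i then w i else 0)"
      using i by (intro sum.cong) auto
    thus ?thesis using True i by simp
  next
    case False
    have "(if (j, k) \<in> parcs (pendant_path n i) then 1 else 0) * (w(n := z)) k =
        (if k = j - 1 then w k else 0) + (if k = j + 1 then w k else 0)
        + (if k = n then (if j = i then z else 0) else 0)"
      if k: "k \<in> {1..n}" for k
    proof (cases "k = n")
      case True
      have "(j, n) \<in> parcs (pendant_path n i) \<longleftrightarrow> j = i"
        using False i by (auto simp: pendant_path_def path_graph_def)
      moreover have "n \<noteq> j - 1" using i j by auto
      moreover have "(if n = j + 1 then w n else 0) = 0" using w by (cases "n = j + 1") auto
      ultimately show ?thesis unfolding True by simp
    next
      case kn: False
      have "(j, k) \<in> parcs (pendant_path n i) \<longleftrightarrow> k = j + 1 \<or> k = j - 1"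
        using False kn j k by (auto simp: pendant_path_def path_graph_def)
      thus ?thesis using kn j by auto
    qed
    hence "(\<Sum>k\<in>{1..n}. (if (j, k) \<in> parcs (pendant_path n i) then 1 else 0) * (w(n := z)) k)
        = (\<Sum>k\<in>{1..n}. (if k = j - 1 then w k else 0) + (if k = j + 1 then w k else 0)
            + (if k = n then (if j = i then z else 0) else 0))"
      by (rule sum.cong[OF refl])
    also have "\<dots> = w (j - 1) + w (j + 1) + (if j = i then z else 0)"
    proof -
      have "(\<Sum>k\<in>{1..n}. if k = j - 1 then w k else 0) = w (j - 1)"
        using j w by (cases "j = 1") auto
      moreover have "(\<Sum>k\<in>{1..n}. if k = j + 1 then w k else 0) = w (j + 1)"
        using j False by simp
      moreover have "(\<Sum>k\<in>{1..n}. if k = n then (if j = i then z else 0) else 0) = (if j = i then z else 0)"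
        using i by simp
      ultimately show ?thesis by (simp only: sum.distrib)
    qed
    finally show ?thesis using False by simp
  qed
  finally show ?thesis .
qed

text \<open>
  Up to a scalar this is column \<open>i\<close> of the resolvent of the path on the vertices \<open>1, \<dots>, n - 1\<close>: on
  each side of \<open>i\<close> it is the solution of the three-term recurrence that vanishes at the end position
  \<open>0\<close> or \<open>n\<close>, and the two solutions are scaled to agree at \<open>i\<close>.
\<close>

definition path_resolvent :: "real \<Rightarrow> nat \<Rightarrow> nat \<Rightarrow> nat \<Rightarrow> complex" where
  "path_resolvent y n i j = \<i> ^ (max i j - min i j) *
     of_real (fib_poly y (min i j) * fib_poly y (n - max i j))"

text \<open>
  Away from \<open>i\<close> this is the recurrence of the Fibonacci polynomials; the jump at \<open>i\<close> is their addition
  formula for \<open>n\<close>.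
\<close>

lemma path_resolvent_equation:
  assumes "1 \<le> i" "i < n" "1 \<le> j" "j < n"
  shows "path_resolvent y n i (j - 1) + path_resolvent y n i (j + 1) + \<i> * of_real y * path_resolvent y n i j
    = (if j = i then \<i> * of_real (fib_poly y n) else 0)"
proof -
  consider "j < i" | "j = i" | "j > i" by linarith
  thus ?thesis
  proof cases
    case 1
    obtain a where a: "j = Suc a" using assms by (cases j) auto
    obtain b where b: "i = Suc (Suc (a + b))" using 1 a less_imp_Suc_add[of j i] by auto
    show ?thesis
      by (simp add: path_resolvent_def a b max_def min_def Suc_diff_le algebra_simps)
  next
    case 2
    obtain a where a: "i = Suc a" using assms by (cases i) auto
    obtain b where b: "n = Suc (Suc (a + b))" using assms a less_imp_Suc_add[of i n] by auto
    have "fib_poly y n = fib_poly y a * fib_poly y (Suc b) + fib_poly y (Suc a) * fib_poly y (Suc (Suc b))"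
      unfolding b using fib_poly_add[of y a "Suc b"] by simp
    thus ?thesis
      by (simp add: path_resolvent_def a b 2 max_def min_def algebra_simps del: fib_poly.simps(3))
         (simp add: algebra_simps)
  next
    case 3
    obtain a where a: "j = Suc (i + a)" using 3 less_imp_Suc_add[of i j] by auto
    obtain b where b: "n = Suc (Suc (i + a + b))" using assms a less_imp_Suc_add[of j n] by auto
    show ?thesis
      by (simp add: path_resolvent_def a b max_def min_def Suc_diff_le algebra_simps)
  qed
qed

text \<open>
  With \<open>R = fib_poly y i * fib_poly y (n - i) / fib_poly y n\<close> this is \<open>R / (y + R)\<close>, which is
  Coulson's integrand for the energy of the added vertex.
\<close>

definition energy_density :: "nat \<Rightarrow> nat \<Rightarrow> real \<Rightarrow> real" where
  "energy_density n i y = fib_poly y i * fib_poly y (n - i) /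
     (y * fib_poly y n + fib_poly y i * fib_poly y (n - i))"

text \<open>
  Since the added vertex hangs on vertex \<open>i\<close> alone, its column of the resolvent of the tree restricts on
  the path to a multiple of column \<open>i\<close> for the path. The equation at \<open>i\<close> then determines the value
  \<open>z\<close> at the added vertex, and the equation at the added vertex determines the scalar \<open>c\<close>.
\<close>

lemma vertex_energy_pendant_path_primitive:
  assumes i: "1 \<le> i" "i < n"
  obtains \<Phi> where "\<Phi> 0 = 0" "continuous_on {0..} \<Phi>"
    "(\<Phi> \<longlongrightarrow> pi / 2 * vertex_energy (pendant_path n i) n) at_top"
    "\<forall>y>0. (\<Phi> has_real_derivative energy_density n i y) (at y)"
proof -
  let ?A = "adjacency_mat (pendant_path n i)"
  obtain \<Phi> where \<Phi>: "\<Phi> 0 = 0" "continuous_on {0..} \<Phi>"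
    "(\<Phi> \<longlongrightarrow> pi / 2 * mat_abs ?A $$ (n - 1, n - 1)) at_top"
    "\<And>y u. y > 0 \<Longrightarrow> resolvent_column ?A (n - 1) y u \<Longrightarrow>
       (\<Phi> has_real_derivative 1 + y * Im (u (n - 1))) (at y)"
    using mat_abs_diagonal_primitive[OF adjacency_mat_pendant_path(1,2)[OF i], of "n - 1"] i by auto
  show thesis
  proof (rule that)
    show "(\<Phi> \<longlongrightarrow> pi / 2 * vertex_energy (pendant_path n i) n) at_top"
      using \<Phi>(3) by (simp add: vertex_energy_def)
    show "\<forall>y>0. (\<Phi> has_real_derivative energy_density n i y) (at y)"
    proof (intro allI impI)
      fix y :: real assume y: "y > 0"
      define q where "q = fib_poly y i * fib_poly y (n - i)"
      define c where "c = 1 / (y * fib_poly y n + q)"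
      have pos: "y * fib_poly y n + q > 0"
        using y i by (auto simp: q_def intro!: add_pos_pos mult_pos_pos fib_poly_pos)
      define w where "w = (\<lambda>j. of_real c * path_resolvent y n i j)"
      define z where "z = - \<i> * of_real (c * fib_poly y n)"
      have w0: "w 0 = 0" "w n = 0" using i by (auto simp: w_def path_resolvent_def)
      have "(\<Sum>k<n. of_real (?A $$ (j, k)) * (w(n := z)) (Suc k)) + \<i> * of_real y * (w(n := z)) (Suc j)
          = (if j = n - 1 then 1 else 0)" if j: "j < n" for j
      proof -
        have "(\<Sum>k<n. of_real (?A $$ (j, k)) * (w(n := z)) (Suc k)) =
            (\<Sum>k<n. (if (Suc j, Suc k) \<in> parcs (pendant_path n i) then 1 else 0) * (w(n := z)) (Suc k))"
          by (rule sum.cong) (use j adjacency_mat_pendant_path(3)[OF i j] in auto)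
        also have "\<dots> = (if Suc j = n then w i else w j + w (Suc j + 1) + (if Suc j = i then z else 0))"
          using pendant_path_neighbour_sum[where w=w and n=n and i=i and j="Suc j" and z=z] i w0 j by simp
        finally have sum: "(\<Sum>k<n. of_real (?A $$ (j, k)) * (w(n := z)) (Suc k)) = \<dots>" .
        show ?thesis
        proof (cases "Suc j = n")
          case True
          have "w i + \<i> * of_real y * z = of_real (c * q + y * (c * fib_poly y n))"
            by (simp add: w_def z_def path_resolvent_def q_def complex_eq_iff)
          also have "c * q + y * (c * fib_poly y n) = 1"
          proof -
            have "c * (y * fib_poly y n + q) = 1" using pos by (simp add: c_def)
            thus ?thesis by (simp add: algebra_simps)
          qed
          finally show ?thesis unfolding sum using True by auto
        next
          case False
          have "w j + w (Suc j + 1) + \<i> * of_real y * w (Suc j) =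
              of_real c * (if Suc j = i then \<i> * of_real (fib_poly y n) else 0)"
            using path_resolvent_equation[of i n "Suc j" y] False j i
            by (simp add: w_def distrib_left[symmetric] mult.left_commute[of _ "of_real c"])
          thus ?thesis unfolding sum using False j by (auto simp: z_def algebra_simps)
        qed
      qed
      hence "resolvent_column ?A (n - 1) y (\<lambda>k. (w(n := z)) (Suc k))"
        using adjacency_mat_pendant_path(1)[OF i] by (simp add: resolvent_column_def del: fun_upd_apply)
      from \<Phi>(4)[OF y this]
      have "(\<Phi> has_real_derivative 1 + y * Im z) (at y)" using i by simp
      also have "1 + y * Im z = q / (y * fib_poly y n + q)"
        using pos by (simp add: z_def c_def field_simps)
      finally show "(\<Phi> has_real_derivative energy_density n i y) (at y)"
        by (simp add: q_def energy_density_def)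
    qed
  qed (fact \<Phi>(1,2))+
qed

text \<open>
  The density is strictly increasing in the product \<open>fib_poly y i * fib_poly y (n - i)\<close>, so a
  comparison of the products for all \<open>y > 0\<close> passes to the energies.
\<close>

lemma vertex_energy_pendant_path_less:
  assumes i: "1 \<le> i" "i < n" and j: "1 \<le> j" "j < n"
    and less: "\<And>y. y > 0 \<Longrightarrow> fib_poly y i * fib_poly y (n - i) < fib_poly y j * fib_poly y (n - j)"
  shows "vertex_energy (pendant_path n i) n < vertex_energy (pendant_path n j) n"
proof -
  obtain f where f: "f 0 = 0" "continuous_on {0..} f"
    "(f \<longlongrightarrow> pi / 2 * vertex_energy (pendant_path n i) n) at_top"
    "\<forall>y>0. (f has_real_derivative energy_density n i y) (at y)"
    using vertex_energy_pendant_path_primitive[OF i] by blast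
  obtain g where g: "g 0 = 0" "continuous_on {0..} g"
    "(g \<longlongrightarrow> pi / 2 * vertex_energy (pendant_path n j) n) at_top"
    "\<forall>y>0. (g has_real_derivative energy_density n j y) (at y)"
    using vertex_energy_pendant_path_primitive[OF j] by blast
  have "pi / 2 * vertex_energy (pendant_path n i) n < pi / 2 * vertex_energy (pendant_path n j) n"
  proof (rule limit_less_of_derivative_less[OF f(1) g(1) f(2) g(2) f(3) g(3) f(4)[rule_format] g(4)[rule_format]])
    fix y :: real assume y: "y > 0"
    define q r where "q = fib_poly y i * fib_poly y (n - i)" and "r = fib_poly y j * fib_poly y (n - j)"
    have "0 < q" "q < r" using y i less by (auto simp: q_def r_def fib_poly_pos)
    moreover define p where "p = y * fib_poly y n"
    moreover have "0 < p" using y i by (simp add: p_def fib_poly_pos)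
    moreover have "q * p < r * p" using \<open>q < r\<close> \<open>0 < p\<close> by (rule mult_strict_right_mono)
    ultimately have "q / (y * fib_poly y n + q) < r / (y * fib_poly y n + r)"
      unfolding p_def[symmetric] by (simp add: field_simps)
    thus "energy_density n i y < energy_density n j y"
      by (simp add: q_def r_def energy_density_def)
  qed
  thus ?thesis by simp
qed

lemma vertex_energy_pendant_path_reflect:
  assumes i: "1 \<le> i" "i < n"
  shows "vertex_energy (pendant_path n (n - i)) n = vertex_energy (pendant_path n i) n"
proof -
  have ni: "1 \<le> n - i" "n - i < n" using i by auto
  obtain f where f: "f 0 = 0" "continuous_on {0..} f"
    "(f \<longlongrightarrow> pi / 2 * vertex_energy (pendant_path n i) n) at_top"
    "\<forall>y>0. (f has_real_derivative energy_density n i y) (at y)"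
    using vertex_energy_pendant_path_primitive[OF i] by blast
  obtain g where g: "g 0 = 0" "continuous_on {0..} g"
    "(g \<longlongrightarrow> pi / 2 * vertex_energy (pendant_path n (n - i)) n) at_top"
    "\<forall>y>0. (g has_real_derivative energy_density n (n - i) y) (at y)"
    using vertex_energy_pendant_path_primitive[OF ni] by blast
  have "energy_density n (n - i) y = energy_density n i y" for y
    using i by (simp add: energy_density_def mult.commute)
  hence "pi / 2 * vertex_energy (pendant_path n i) n = pi / 2 * vertex_energy (pendant_path n (n - i)) n"
    using limit_eq_of_derivative_eq[OF f(1) g(1) f(2) g(2) f(3) g(3) f(4)[rule_format]] g(4) by simp
  thus ?thesis by simp
qed

section \<open>The order of the energies\<close>

lemma increasing_along_appendI:
  "increasing_along f xs \<Longrightarrow> increasing_along f ys \<Longrightarrow>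
   (\<And>x y. x \<in> set xs \<Longrightarrow> y \<in> set ys \<Longrightarrow> f x < f y) \<Longrightarrow> increasing_along f (xs @ ys)"
  by (auto simp: increasing_along_def sorted_wrt_append)

lemma set_evens_up_to: "set (evens_up_to m) = {a. even a \<and> 1 \<le> a \<and> a \<le> m}"
  by (auto simp: evens_up_to_def simp del: upt_Suc)

lemma set_odds_down_from: "set (odds_down_from m) = {a. odd a \<and> 1 \<le> a \<and> a \<le> m}"
  by (auto simp: odds_down_from_def simp del: upt_Suc)

lemma increasing_along_evens_up_to:
  assumes "\<And>a b. even a \<Longrightarrow> even b \<Longrightarrow> 1 \<le> a \<Longrightarrow> a < b \<Longrightarrow> b \<le> m \<Longrightarrow> f a < f b"
  shows "increasing_along f (evens_up_to m)"
proof -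
  have "sorted_wrt (<) (filter even [1..<Suc m])" by (intro sorted_wrt_filter) (simp del: upt_Suc)
  thus ?thesis
    unfolding increasing_along_def evens_up_to_def sorted_wrt_map
    by (rule sorted_wrt_mono_rel[rotated]) (use assms in \<open>auto simp del: upt_Suc\<close>)
qed

lemma increasing_along_odds_down_from:
  assumes "\<And>a b. odd a \<Longrightarrow> odd b \<Longrightarrow> 1 \<le> a \<Longrightarrow> a < b \<Longrightarrow> b \<le> m \<Longrightarrow> f b < f a"
  shows "increasing_along f (odds_down_from m)"
proof -
  have "sorted_wrt (<) (filter odd [1..<Suc m])" by (intro sorted_wrt_filter) (simp del: upt_Suc)
  thus ?thesis
    unfolding increasing_along_def odds_down_from_def sorted_wrt_map sorted_wrt_rev
    by (rule sorted_wrt_mono_rel[rotated]) (use assms in \<open>auto simp del: upt_Suc\<close>)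
qed

theorem corollary4p12:
  fixes n k :: nat and t :: int and \<E> :: "nat \<Rightarrow> real"
  assumes "n \<ge> 2"
    and "k = n div 2"
    and "\<forall>i\<in>{1..n - 1}. \<E> i = vertex_energy (pendant_path n i) n"
  shows "(int n = 4 * t \<longrightarrow>
            increasing_along \<E> (evens_up_to k @ odds_down_from (k - 1))) \<and>
         (int n = 4 * t + 2 \<longrightarrow>
            increasing_along \<E> (evens_up_to (k - 1) @ odds_down_from k)) \<and>
         (int n = 4 * t + 1 \<longrightarrow>
            increasing_along \<E> (evens_up_to k) \<and>
            \<E> k = \<E> (k + 1) \<and>
            increasing_along \<E> (odds_down_from (k + 1))) \<and>
         (int n = 4 * t + 3 \<longrightarrow>
            increasing_along \<E> (evens_up_to (k + 1)) \<and>
            \<E> (k + 1) = \<E> k \<and>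
            increasing_along \<E> (odds_down_from k))"
proof -
  have up: "\<E> a < \<E> b" if "even a" "1 \<le> a" "a < b" "a + b < n" for a b
    using that assms(1,3) vertex_energy_pendant_path_less[of a n b] fib_poly_product_less(1)[of _ a b n]
    by auto
  have down: "\<E> b < \<E> a" if "odd a" "1 \<le> a" "a < b" "a + b < n" for a b
    using that assms(1,3) vertex_energy_pendant_path_less[of b n a] fib_poly_product_less(2)[of _ a b n]
    by auto
  \<comment> \<open>Whichever of the two indices is smaller, its parity decides in favour of the odd one.\<close>
  have up_down: "\<E> a < \<E> b" if "even a" "odd b" "1 \<le> a" "1 \<le> b" "a + b < n" for a b
    using up[of a b] down[of b a] that by (cases a b rule: linorder_cases) (auto simp: add.commute)
  \<comment> \<open>Reflecting the path identifies the two middle positions when \<open>n\<close> is odd.\<close>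
  have reflect: "\<E> (n - i) = \<E> i" if "1 \<le> i" "i < n" for i
  proof -
    have "i \<in> {1..n - 1}" "n - i \<in> {1..n - 1}" using that by auto
    thus ?thesis using assms(3) vertex_energy_pendant_path_reflect[OF that] by simp
  qed
  have evens: "increasing_along \<E> (evens_up_to m)"
    if "\<And>a b. even a \<Longrightarrow> even b \<Longrightarrow> a < b \<Longrightarrow> b \<le> m \<Longrightarrow> a + b < n" for m
    by (rule increasing_along_evens_up_to) (metis up that)
  have odds: "increasing_along \<E> (odds_down_from m)"
    if "\<And>a b. odd a \<Longrightarrow> odd b \<Longrightarrow> a < b \<Longrightarrow> b \<le> m \<Longrightarrow> a + b < n" for m
    by (rule increasing_along_odds_down_from) (metis down that)
  have chain: "increasing_along \<E> (evens_up_to l @ odds_down_from m)"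
    if "l + m < n" "l \<le> k" "m \<le> k" for l m
  proof (rule increasing_along_appendI)
    show "increasing_along \<E> (evens_up_to l)" by (rule evens) (use that assms(2) in linarith)
    show "increasing_along \<E> (odds_down_from m)" by (rule odds) (use that assms(2) in linarith)
    fix a b assume "a \<in> set (evens_up_to l)" "b \<in> set (odds_down_from m)"
    thus "\<E> a < \<E> b"
      using that by (intro up_down) (auto simp: set_evens_up_to set_odds_down_from)
  qed
  show ?thesis
  proof (intro conjI impI)
    assume "int n = 4 * t"
    hence "even n" by presburger
    show "increasing_along \<E> (evens_up_to k @ odds_down_from (k - 1))"
      by (rule chain) (use assms(1,2) \<open>even n\<close> in \<open>auto elim!: evenE\<close>)
  next
    assume "int n = 4 * t + 2"
    hence "even n" by presburger
    show "increasing_along \<E> (evens_up_to (k - 1) @ odds_down_from k)"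
      by (rule chain) (use assms(1,2) \<open>even n\<close> in \<open>auto elim!: evenE\<close>)
  next
    assume "int n = 4 * t + 1"
    hence k: "n = 2 * k + 1" "even k" using assms(2) by presburger+
    have k1: "a + b < n" if "odd a" "odd b" "a < b" "b \<le> k + 1" for a b
    proof -
      have "Suc a \<le> k" using that k(2) by presburger
      thus ?thesis using that(4) k(1) by simp
    qed
    show "increasing_along \<E> (evens_up_to k)"
      by (rule evens) (use k in auto)
    show "\<E> k = \<E> (k + 1)" using reflect[of k] k assms(1) by simp
    show "increasing_along \<E> (odds_down_from (k + 1))"
      by (rule odds) (rule k1)
  next
    assume "int n = 4 * t + 3"
    hence k: "n = 2 * k + 1" "odd k" using assms(2) by presburger+
    have k1: "a + b < n" if "even a" "even b" "a < b" "b \<le> k + 1" for a b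
    proof -
      have "Suc a \<le> k" using that k(2) by presburger
      thus ?thesis using that(4) k(1) by simp
    qed
    show "increasing_along \<E> (evens_up_to (k + 1))"
      by (rule evens) (rule k1)
    show "\<E> (k + 1) = \<E> k" using reflect[of k] k assms(1) by simp
    show "increasing_along \<E> (odds_down_from k)"
      by (rule odds) (use k in auto)
  qed
qed

end
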